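(* Let $Y$ be a locally finite, connected graph, and let $q^{(n)}(x,y)$ be the $n$-step transition probabilities (with $q=q^{(1)}$) of a reversible Markov chain on $Y$ which is of nearest neighbourhood type. Then $$q^{(n)}(x,y)\,q^{(n)}(y,x)\le 4^{1-n}$$ for different vertices $x$ and $y$ which are at distance $n=d(x,y)$ from each other. Here equality holds if and only if $$\sum_{\substack{w\in VY\\ d(y,w)<d(y,x)}}q(x,w)=\sum_{\substack{w\in VY\\ d(x,w)<d(x,y)}}q(y,w)=1$$ and $$\sum_{\substack{w\in VY\\ d(x,w)<d(x,v)}}q(v,w)=\sum_{\substack{w\in VY\\ d(y,w)<d(y,v)}}q(v,w)=\frac12$$ for all $v\in VY\setminus\{x,y\}$, that is, the Markov chain can be projected to the simple random walk on the line $L_n$.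
   Context: Graphs $Y=(VY,EY)$ are undirected, without loops or multiple edges; $d$ is the graph distance of $Y$. The Markov chain has state space $VY$; it is of nearest neighbourhood type, meaning that $q(x,y)>0$ if and only if $x$ and $y$ are adjacent in $Y$. It is reversible, meaning that there is a positive function $m$ on $VY$ with $m(x)q(x,y)=m(y)q(y,x)$ for all $x,y\in VY$. $L_n$ is the line of length $n$, i.e. the path graph with vertices $x_0,\dots,x_n$ and edges $\{x_{i-1},x_i\}$, $1\le i\le n$. *)

theory Defs
  imports "HOL-Analysis.Infinite_Sum"
begin

text \<open>
  A graph is a vertex set together with a set of two-element subsets of it; this
  excludes loops and multiple edges. The vertex set may be infinite.
\<close>

definition simple_graph :: "'a set \<Rightarrow> 'a set set \<Rightarrow> bool" where
  "simple_graph V E \<longleftrightarrow> (\<forall>e\<in>E. \<exists>u\<in>V. \<exists>v\<in>V. u \<noteq> v \<and> e = {u, v})"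

definition adj :: "'a set set \<Rightarrow> ('a \<times> 'a) set" where
  "adj E = {(u, v). {u, v} \<in> E}"

definition locally_finite_graph :: "'a set \<Rightarrow> 'a set set \<Rightarrow> bool" where
  "locally_finite_graph V E \<longleftrightarrow> (\<forall>v\<in>V. finite (adj E `` {v}))"

definition connected_graph :: "'a set \<Rightarrow> 'a set set \<Rightarrow> bool" where
  "connected_graph V E \<longleftrightarrow> (\<forall>u\<in>V. \<forall>v\<in>V. (u, v) \<in> (adj E)\<^sup>*)"

text \<open>
  \<open>(u, v) \<in> adj E ^^ k\<close> says that there is a walk of length \<open>k\<close> from \<open>u\<close> to \<open>v\<close>.
  The value is meaningful only if some walk exists, as is the case for any two
  vertices of a connected graph.
\<close>

definition graph_dist :: "'a set set \<Rightarrow> 'a \<Rightarrow> 'a \<Rightarrow> nat" where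
  "graph_dist E u v = (LEAST k. (u, v) \<in> adj E ^^ k)"

text \<open>
  Transition kernels are functions on the whole type, of which only the values on
  the state space are relevant. State spaces may be infinite, hence the use of
  unordered infinite sums.
\<close>

definition markov_chain :: "'a set \<Rightarrow> ('a \<Rightarrow> 'a \<Rightarrow> real) \<Rightarrow> bool" where
  "markov_chain V q \<longleftrightarrow> (\<forall>u\<in>V. (\<forall>v\<in>V. q u v \<ge> 0) \<and> (q u has_sum 1) V)"

definition nearest_neighbour :: "'a set \<Rightarrow> 'a set set \<Rightarrow> ('a \<Rightarrow> 'a \<Rightarrow> real) \<Rightarrow> bool" where
  "nearest_neighbour V E q \<longleftrightarrow> (\<forall>u\<in>V. \<forall>v\<in>V. q u v > 0 \<longleftrightarrow> (u, v) \<in> adj E)"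

definition reversible_chain :: "'a set \<Rightarrow> ('a \<Rightarrow> 'a \<Rightarrow> real) \<Rightarrow> bool" where
  "reversible_chain V q \<longleftrightarrow>
     (\<exists>m :: 'a \<Rightarrow> real. (\<forall>u\<in>V. m u > 0) \<and> (\<forall>u\<in>V. \<forall>v\<in>V. m u * q u v = m v * q v u))"

fun nstep :: "'a set \<Rightarrow> ('a \<Rightarrow> 'a \<Rightarrow> real) \<Rightarrow> nat \<Rightarrow> 'a \<Rightarrow> 'a \<Rightarrow> real" where
  "nstep V q 0 u v = (if u = v then 1 else 0)"
| "nstep V q (Suc k) u v = (\<Sum>\<^sub>\<infinity>w\<in>V. q u w * nstep V q k w v)"

text \<open>The line of length \<open>n\<close>, with the number \<open>i\<close> in the role of the vertex \<open>x\<^sub>i\<close>.\<close>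

definition line_verts :: "nat \<Rightarrow> nat set" where
  "line_verts n = {0..n}"

definition line_edges :: "nat \<Rightarrow> nat set set" where
  "line_edges n = (\<lambda>i. {i - 1, i}) ` {1..n}"

definition simple_random_walk :: "'a set set \<Rightarrow> 'a \<Rightarrow> 'a \<Rightarrow> real" where
  "simple_random_walk E u v =
     (if (u, v) \<in> adj E then 1 / real (card (adj E `` {u})) else 0)"

definition chain_projection ::
    "'a set \<Rightarrow> ('a \<Rightarrow> 'a \<Rightarrow> real) \<Rightarrow> 'b set \<Rightarrow> ('b \<Rightarrow> 'b \<Rightarrow> real) \<Rightarrow> ('a \<Rightarrow> 'b) \<Rightarrow> bool" where
  "chain_projection V q W p \<pi> \<longleftrightarrow>
     \<pi> ` V = W \<and>
     (\<forall>v\<in>V. \<forall>j\<in>W. (\<Sum>\<^sub>\<infinity>w\<in>{w \<in> V. \<pi> w = j}. q v w) = p (\<pi> v) j)"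

text \<open>
  The fibres over the two ends of the line are required to be exactly \<open>{x}\<close> and
  \<open>{y}\<close>. Asking only for \<open>\<pi> x = 0\<close> and \<open>\<pi> y = n\<close> would admit foldings: the simple
  random walk on the integers folds onto every line of positive length, in such a way
  that \<open>0\<close> and \<open>n\<close> are mapped to its ends.
\<close>

definition projects_to_line ::
    "'a set \<Rightarrow> ('a \<Rightarrow> 'a \<Rightarrow> real) \<Rightarrow> 'a \<Rightarrow> 'a \<Rightarrow> nat \<Rightarrow> bool" where
  "projects_to_line V q x y n \<longleftrightarrow>
     (\<exists>\<pi>. chain_projection V q (line_verts n) (simple_random_walk (line_edges n)) \<pi> \<and>
          {v \<in> V. \<pi> v = 0} = {x} \<and> {v \<in> V. \<pi> v = n} = {y})"

end

theory Submission
  imports Defs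
begin

text \<open>
  On the set \<open>S\<close> of vertices lying on geodesics from \<open>x\<close> to \<open>y\<close>, let \<open>h v = d(v, y)\<close>, let
  \<open>p v\<close> be the probability of reaching \<open>y\<close> from \<open>v\<close> in exactly \<open>h v\<close> steps, and let \<open>s\<^sub>k\<close> be the norm of the restriction of \<open>p\<close> to the layer \<open>h = k\<close>
  in the \<open>\<ell>\<^sup>2\<close> space weighted by the reversing measure \<open>m\<close>. By reversibility, the product
  of the two \<open>n\<close>-step probabilities is \<open>(s\<^sub>n / s\<^sub>0)\<^sup>2\<close>. Rescale \<open>p\<close> on each layer to a
  function \<open>F\<close> whose squared norms on the layers are \<open>1, 2, \<dots>, 2, 1\<close>, the stationary
  weights of the simple random walk on the line. The Dirichlet form of \<open>F\<close> is nonnegative,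
  and it is at most \<open>2n - 2(T\<^sub>0 + \<dots> + T\<^sub>n\<^sub>-\<^sub>1)\<close>, where \<open>T\<^sub>k\<close> is the inner product of \<open>F\<close> on
  layer \<open>k + 1\<close> with the image of \<open>F\<close> on layer \<open>k\<close> under the kernel. Hence the product of
  the \<open>T\<^sub>k\<close>, which is \<open>2\<^sup>n\<^sup>-\<^sup>1 s\<^sub>n / s\<^sub>0\<close>, is at most \<open>1\<close> by the inequality between arithmetic and
  geometric mean. Equality forces the Dirichlet form to vanish, so that \<open>F\<close> is constant, no
  transition leaves \<open>S\<close> or stays within a layer, and all \<open>T\<^sub>k\<close> are \<open>1\<close>; together these
  give the drift conditions.
\<close>

section \<open>The inequality between arithmetic and geometric mean, with its equality case\<close>

text \<open>Summing \<open>ln t <= t - 1\<close> over the factors bounds the logarithm of the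
  product by 0. If the product is 1, all the nonnegative gaps \<open>T k - 1 - ln (T k)\<close>
  vanish, and the tangent line of \<open>ln\<close> at 1 touches it only there.\<close>

lemma prod_le_1_if_sum_le:
  fixes T :: "nat \<Rightarrow> real"
  assumes pos: "\<And>k. k < n \<Longrightarrow> 0 < T k" and le: "(\<Sum>k<n. T k) \<le> real n"
  shows "(\<Prod>k<n. T k) \<le> 1"
    and "(\<Prod>k<n. T k) = 1 \<Longrightarrow> k < n \<Longrightarrow> T k = 1"
proof -
  have ln_prod: "ln (\<Prod>k<n. T k) = (\<Sum>k<n. ln (T k))"
    by (rule ln_prod) (use pos in fastforce)+
  have nonneg: "0 \<le> T k - 1 - ln (T k)" if "k < n" for k
    using ln_le_minus_one[OF pos[OF that]] by simp
  have sum_eq: "(\<Sum>k<n. T k - 1 - ln (T k)) = (\<Sum>k<n. T k) - n - ln (\<Prod>k<n. T k)"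
    by (simp add: ln_prod sum_subtractf)
  have "0 \<le> (\<Sum>k<n. T k - 1 - ln (T k))"
    using nonneg by (intro sum_nonneg) auto
  then have "ln (\<Prod>k<n. T k) \<le> 0"
    using le sum_eq by linarith
  moreover have "0 < (\<Prod>k<n. T k)"
    using pos by (intro prod_pos) auto
  ultimately show "(\<Prod>k<n. T k) \<le> 1"
    by simp
  show "T k = 1" if "(\<Prod>k<n. T k) = 1" "k < n"
  proof -
    have "(\<Sum>k<n. T k - 1 - ln (T k)) \<le> 0"
      using sum_eq that le by simp
    then have "(\<Sum>k<n. T k - 1 - ln (T k)) = 0"
      using \<open>0 \<le> (\<Sum>k<n. T k - 1 - ln (T k))\<close> by linarith
    then have "T k - 1 - ln (T k) = 0"
      using nonneg \<open>k < n\<close> by (subst (asm) sum_nonneg_eq_0_iff) auto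
    then show ?thesis
      using ln_eq_minus_one[OF pos[OF \<open>k < n\<close>]] by simp
  qed
qed

section \<open>The Dirichlet form on a finite layered set\<close>

text \<open>The kernel is only substochastic on \<open>S\<close>, since the chain may step out of
  \<open>S\<close>. The recursion \<open>p_step\<close> describes a descent by exactly one layer at
  each step.\<close>

locale layered_chain =
  fixes S :: "'a set" and h :: "'a \<Rightarrow> nat" and q :: "'a \<Rightarrow> 'a \<Rightarrow> real"
    and m p :: "'a \<Rightarrow> real" and n :: nat and x y :: 'a
  assumes fin: "finite S"
    and n_pos: "0 < n"
    and h_le: "v \<in> S \<Longrightarrow> h v \<le> n"
    and bottom: "{v \<in> S. h v = 0} = {y}"
    and top: "{v \<in> S. h v = n} = {x}"
    and q_nonneg: "u \<in> S \<Longrightarrow> v \<in> S \<Longrightarrow> 0 \<le> q u v"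
    and q_sum: "v \<in> S \<Longrightarrow> (\<Sum>w\<in>S. q v w) \<le> 1"
    and m_pos: "v \<in> S \<Longrightarrow> 0 < m v"
    and rev: "u \<in> S \<Longrightarrow> v \<in> S \<Longrightarrow> m u * q u v = m v * q v u"
    and p_pos: "v \<in> S \<Longrightarrow> 0 < p v"
    and p_y: "p y = 1"
    and p_step: "v \<in> S \<Longrightarrow> h v = Suc k \<Longrightarrow> p v = (\<Sum>w | w \<in> S \<and> h w = k. q v w * p w)"
begin

text \<open>The squared norm prescribed for \<open>F\<close> on layer \<open>k\<close>: the degree
  of the vertex \<open>k\<close> in the line.\<close>

definition c2 :: "nat \<Rightarrow> real" where
  "c2 k = (if k = 0 \<or> k = n then 1 else 2)"

definition s :: "nat \<Rightarrow> real" where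
  "s k = sqrt (\<Sum>v | v \<in> S \<and> h v = k. m v * (p v)\<^sup>2)"

definition F :: "'a \<Rightarrow> real" where
  "F v = sqrt (c2 (h v)) * p v / s (h v)"

text \<open>Closed form of an inner product between consecutive layers, identified as such in the
  proof of \<open>cross_sum\<close>. In this form the product over \<open>k\<close>
  telescopes.\<close>

definition T :: "nat \<Rightarrow> real" where
  "T k = sqrt (c2 k) * sqrt (c2 (Suc k)) * s (Suc k) / s k"

definition down :: "'a \<Rightarrow> real" where
  "down v = (\<Sum>w | w \<in> S \<and> h v = Suc (h w). q v w)"

definition up :: "'a \<Rightarrow> real" where
  "up v = (\<Sum>w | w \<in> S \<and> h w = Suc (h v). q v w)"

text \<open>The part of the Dirichlet form that comes from consecutive layers, each pair of vertices
  being counted once, from its upper end.\<close>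

definition energy :: real where
  "energy = (\<Sum>u\<in>S. \<Sum>v | v \<in> S \<and> h u = Suc (h v). m u * q u v * (F u - F v)\<^sup>2)"

text \<open>The weight of all transitions other than those within \<open>S\<close> between
  consecutive layers.\<close>

definition leak :: real where
  "leak = (\<Sum>v\<in>S. m v * (F v)\<^sup>2 * (1 - (down v + up v)))"

lemma c2_pos: "0 < c2 k"
  by (simp add: c2_def)

text \<open>Descend from the top layer: as \<open>p v\<close> is positive, the sum in
  \<open>p_step\<close> cannot be empty, which provides a vertex one layer below.\<close>

lemma layer_nonempty: "k \<le> n \<Longrightarrow> \<exists>v\<in>S. h v = k"
proof (induction rule: inc_induct)
  case base
  show ?case using top by blast
next
  case (step k)
  then obtain v where v: "v \<in> S" "h v = Suc k" by blast
  have "(\<Sum>w | w \<in> S \<and> h w = k. q v w * p w) \<noteq> 0"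
    using p_step[OF v] p_pos[OF v(1)] by simp
  then show ?case
    by (metis (mono_tags, lifting) empty_Collect_eq sum.empty)
qed

lemma s_pos: "k \<le> n \<Longrightarrow> 0 < s k"
  using layer_nonempty[of k] fin m_pos p_pos unfolding s_def
  by (auto intro!: sum_pos mult_pos_pos zero_less_power)

lemma s_square: "(s k)\<^sup>2 = (\<Sum>v | v \<in> S \<and> h v = k. m v * (p v)\<^sup>2)"
  unfolding s_def using m_pos
  by (intro real_sqrt_pow2 sum_nonneg) (auto intro!: mult_nonneg_nonneg simp: less_imp_le)

lemma F_pos: "v \<in> S \<Longrightarrow> 0 < F v"
  unfolding F_def using c2_pos p_pos s_pos h_le by simp

lemma T_pos: "k < n \<Longrightarrow> 0 < T k"
  unfolding T_def using c2_pos s_pos[of k] s_pos[of "Suc k"] by simp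

lemma sum_layers: "(\<Sum>v\<in>S. g v) = (\<Sum>k\<le>n. \<Sum>v | v \<in> S \<and> h v = k. g v)" for g :: "'a \<Rightarrow> real"
  using fin h_le by (subst sum.group[of S "{..n}" h g]) auto

text \<open>Layer \<open>k\<close> carries mass \<open>c2 k\<close> by the choice of
  \<open>F\<close>, and the degrees of the line add up to twice its number of edges.\<close>

lemma sum_mass: "(\<Sum>v\<in>S. m v * (F v)\<^sup>2) = 2 * real n"
proof -
  have "(\<Sum>v | v \<in> S \<and> h v = k. m v * (F v)\<^sup>2) = c2 k" if "k \<le> n" for k
  proof -
    have "(\<Sum>v | v \<in> S \<and> h v = k. m v * (F v)\<^sup>2)
        = (\<Sum>v | v \<in> S \<and> h v = k. c2 k / (s k)\<^sup>2 * (m v * (p v)\<^sup>2))"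
      using c2_pos[of k] by (intro sum.cong) (auto simp: F_def power_mult_distrib power_divide)
    also have "\<dots> = c2 k"
      unfolding sum_distrib_left[symmetric] s_square[symmetric] using s_pos[OF that] by simp
    finally show ?thesis .
  qed
  then have mass: "(\<Sum>v\<in>S. m v * (F v)\<^sup>2) = (\<Sum>k\<le>n. c2 k)"
    by (simp add: sum_layers)
  obtain r where r: "n = Suc r"
    using n_pos gr0_implies_Suc by blast
  have c2: "c2 0 = 1" "c2 (Suc r) = 1" "\<And>i. i < r \<Longrightarrow> c2 (Suc i) = 2"
    unfolding c2_def using r by auto
  have "(\<Sum>k\<le>Suc r. c2 k) = c2 0 + (\<Sum>k<Suc r. c2 (Suc k))"
    unfolding lessThan_Suc_atMost by (rule sum.atMost_Suc_shift)
  also have "\<dots> = 2 * real (Suc r)"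
    by (simp add: c2)
  finally have "(\<Sum>k\<le>Suc r. c2 k) = 2 * real (Suc r)" .
  then have "(\<Sum>k\<le>n. c2 k) = 2 * real n"
    by (simp only: r)
  then show ?thesis
    by (simp only: mass)
qed

lemma F_step:
  assumes "v \<in> S" "h v = Suc k"
  shows "(\<Sum>w | w \<in> S \<and> h w = k. q v w * F w) = sqrt (c2 k) / s k * p v"
proof -
  have "(\<Sum>w | w \<in> S \<and> h w = k. q v w * F w)
      = (\<Sum>w | w \<in> S \<and> h w = k. sqrt (c2 k) / s k * (q v w * p w))"
    by (intro sum.cong) (auto simp: F_def)
  then show ?thesis
    by (simp add: p_step[OF assms] sum_distrib_left)
qed

text \<open>By \<open>F_step\<close>, the inner sum at a vertex \<open>u\<close> of layer
  \<open>k + 1\<close> is a constant multiple of \<open>m u * (p u)^2\<close>, so the layer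
  contributes a multiple of the square of \<open>s (Suc k)\<close>. The bottom layer has nothing
  below it and contributes 0.\<close>

lemma cross_sum:
  "(\<Sum>u\<in>S. \<Sum>v | v \<in> S \<and> h u = Suc (h v). m u * q u v * F u * F v) = (\<Sum>k<n. T k)"
proof -
  let ?g = "\<lambda>u. \<Sum>v | v \<in> S \<and> h u = Suc (h v). m u * q u v * F u * F v"
  obtain r where r: "n = Suc r"
    using n_pos gr0_implies_Suc by blast
  have layer: "(\<Sum>u | u \<in> S \<and> h u = Suc k. ?g u) = T k" if "k < n" for k
  proof -
    have "?g u = sqrt (c2 (Suc k)) * sqrt (c2 k) / (s k * s (Suc k)) * (m u * (p u)\<^sup>2)"
      if u: "u \<in> S" "h u = Suc k" for u
    proof -
      have "?g u = m u * F u * (\<Sum>v | v \<in> S \<and> h v = k. q u v * F v)"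
        unfolding sum_distrib_left using u by (intro sum.cong) (auto simp: mult_ac)
      also have "\<dots> = m u * F u * (sqrt (c2 k) / s k * p u)"
        by (simp only: F_step[OF u])
      also have "\<dots> = sqrt (c2 (Suc k)) * sqrt (c2 k) / (s k * s (Suc k)) * (m u * (p u)\<^sup>2)"
        using u by (simp add: F_def power2_eq_square mult_ac)
      finally show ?thesis .
    qed
    then have "(\<Sum>u | u \<in> S \<and> h u = Suc k. ?g u)
       = sqrt (c2 (Suc k)) * sqrt (c2 k) / (s k * s (Suc k)) * (s (Suc k))\<^sup>2"
      by (simp add: s_square sum_distrib_left)
    also have "\<dots> = T k"
      using s_pos[of "Suc k"] that by (simp add: T_def power2_eq_square)
    finally show ?thesis .
  qed
  have "(\<Sum>u\<in>S. ?g u) = (\<Sum>k\<le>n. \<Sum>u | u \<in> S \<and> h u = k. ?g u)"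
    by (rule sum_layers)
  also have "\<dots> = (\<Sum>u | u \<in> S \<and> h u = 0. ?g u) + (\<Sum>k\<le>r. \<Sum>u | u \<in> S \<and> h u = Suc k. ?g u)"
    unfolding r by (rule sum.atMost_Suc_shift)
  also have "(\<Sum>u | u \<in> S \<and> h u = 0. ?g u) = 0"
    by (intro sum.neutral) auto
  also have "(\<Sum>k\<le>r. \<Sum>u | u \<in> S \<and> h u = Suc k. ?g u) = (\<Sum>k<n. T k)"
    unfolding r lessThan_Suc_atMost using layer by (intro sum.cong) (auto simp: r)
  finally show ?thesis by simp
qed

text \<open>Expand the squares in \<open>energy\<close>. The terms in \<open>F u\<close> collect the
  downward transitions; by reversibility, the terms in \<open>F v\<close> collect the upward ones.
  Adding \<open>leak\<close> completes these to the total mass, and the mixed terms are given by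
  \<open>cross_sum\<close>.\<close>

lemma energy_identity: "energy + leak + 2 * (\<Sum>k<n. T k) = 2 * real n"
proof -
  have "energy = (\<Sum>u\<in>S. \<Sum>v | v \<in> S \<and> h u = Suc (h v). m u * q u v * (F u)\<^sup>2)
      + (\<Sum>u\<in>S. \<Sum>v | v \<in> S \<and> h u = Suc (h v). m u * q u v * (F v)\<^sup>2)
      - 2 * (\<Sum>u\<in>S. \<Sum>v | v \<in> S \<and> h u = Suc (h v). m u * q u v * F u * F v)"
    unfolding energy_def sum_distrib_left sum.distrib[symmetric] sum_subtractf[symmetric]
    by (intro sum.cong) (auto simp: power2_eq_square algebra_simps)
  moreover have "(\<Sum>u\<in>S. \<Sum>v | v \<in> S \<and> h u = Suc (h v). m u * q u v * (F u)\<^sup>2)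
      = (\<Sum>u\<in>S. m u * (F u)\<^sup>2 * down u)"
    unfolding down_def sum_distrib_left by (intro sum.cong) auto
  moreover have "(\<Sum>u\<in>S. \<Sum>v | v \<in> S \<and> h u = Suc (h v). m u * q u v * (F v)\<^sup>2)
      = (\<Sum>v\<in>S. m v * (F v)\<^sup>2 * up v)"
    unfolding up_def sum_distrib_left
    by (subst sum.swap_restrict) (auto simp: fin rev intro!: sum.cong)
  moreover have "leak = (\<Sum>v\<in>S. m v * (F v)\<^sup>2) - ((\<Sum>u\<in>S. m u * (F u)\<^sup>2 * down u)
      + (\<Sum>v\<in>S. m v * (F v)\<^sup>2 * up v))"
    unfolding leak_def sum.distrib[symmetric] sum_subtractf[symmetric]
    by (intro sum.cong) (auto simp: algebra_simps)
  ultimately show ?thesis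
    by (simp add: cross_sum sum_mass)
qed

lemma down_up_le: "v \<in> S \<Longrightarrow> down v + up v \<le> 1"
proof -
  assume v: "v \<in> S"
  have "down v + up v = (\<Sum>w\<in>{w \<in> S. h v = Suc (h w)} \<union> {w \<in> S. h w = Suc (h v)}. q v w)"
    unfolding down_def up_def using fin by (intro sum.union_disjoint[symmetric]) auto
  also have "\<dots> \<le> (\<Sum>w\<in>S. q v w)"
    using fin q_nonneg v by (intro sum_mono2) auto
  finally show ?thesis using q_sum[OF v] by simp
qed

lemma energy_nonneg: "0 \<le> energy"
  unfolding energy_def using m_pos q_nonneg
  by (intro sum_nonneg) (auto intro!: mult_nonneg_nonneg simp: less_imp_le)

lemma leak_nonneg: "0 \<le> leak"
  unfolding leak_def using m_pos down_up_le
  by (intro sum_nonneg mult_nonneg_nonneg) (auto simp: less_imp_le)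

lemma sum_T_le: "(\<Sum>k<n. T k) \<le> real n"
  using energy_identity energy_nonneg leak_nonneg by linarith

text \<open>The quotients of norms telescope to \<open>s n / s 0\<close>, and the extreme layers are
  single vertices. Each of the \<open>n - 1\<close> inner layers has weight 2 and enters two
  factors, whence the power of 4 after squaring.\<close>

lemma prod_T: "(\<Prod>k<n. T k)\<^sup>2 = 4 ^ (n - 1) * (m x * (p x)\<^sup>2 / m y)"
proof -
  obtain r where r: "n = Suc r"
    using n_pos gr0_implies_Suc by blast
  have "j \<le> n \<Longrightarrow> (\<Prod>k<j. s (Suc k) / s k) = s j / s 0" for j
  proof (induction j)
    case (Suc j)
    then show ?case using s_pos[of j] by simp
  qed (use s_pos[of 0] in simp)
  then have tel: "(\<Prod>k<n. s (Suc k) / s k) = s n / s 0"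
    by simp
  have c2: "c2 0 = 1" "c2 (Suc r) = 1" "\<And>i. i < r \<Longrightarrow> c2 (Suc i) = 2"
    unfolding c2_def using r by auto
  have "(\<Prod>k<Suc r. c2 k) = 2 ^ r"
    unfolding prod.lessThan_Suc_shift by (simp add: c2)
  then have "(\<Prod>k<n. c2 k) = 2 ^ (n - 1)"
    by (simp only: r diff_Suc_1)
  moreover have "(\<Prod>k<Suc r. c2 (Suc k)) = 2 ^ r"
    unfolding prod.lessThan_Suc by (simp add: c2)
  then have "(\<Prod>k<n. c2 (Suc k)) = 2 ^ (n - 1)"
    by (simp only: r diff_Suc_1)
  ultimately have "(\<Prod>k<n. c2 k * c2 (Suc k)) = 4 ^ (n - 1)"
    by (simp add: prod.distrib power_mult_distrib[symmetric])
  moreover have "(s n)\<^sup>2 = m x * (p x)\<^sup>2" "(s 0)\<^sup>2 = m y"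
    by (simp_all add: s_square top bottom p_y)
  moreover have "(\<Prod>k<n. T k)\<^sup>2 = (\<Prod>k<n. c2 k * c2 (Suc k)) * (\<Prod>k<n. s (Suc k) / s k)\<^sup>2"
    unfolding prod_power_distrib prod.distrib[symmetric] using c2_pos
    by (intro prod.cong) (auto simp: T_def power_mult_distrib power_divide less_imp_le)
  ultimately show ?thesis
    by (simp add: tel power_divide)
qed

lemma prod_T_pos: "0 < (\<Prod>k<n. T k)"
  using T_pos by (intro prod_pos) auto

lemma weight_le: "4 ^ (n - 1) * (m x * (p x)\<^sup>2 / m y) \<le> 1"
  unfolding prod_T[symmetric]
  using prod_le_1_if_sum_le(1)[OF T_pos sum_T_le] prod_T_pos by (simp add: power_le_one)

section \<open>Equality in the bound for a layered chain\<close>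

context
  assumes extremal: "4 ^ (n - 1) * (m x * (p x)\<^sup>2 / m y) = 1"
begin

lemma T_eq_1: "k < n \<Longrightarrow> T k = 1"
proof -
  have "(\<Prod>k<n. T k) = 1"
    using prod_T prod_T_pos unfolding extremal power2_eq_1_iff by linarith
  then show "k < n \<Longrightarrow> T k = 1"
    using prod_le_1_if_sum_le(2)[OF T_pos sum_T_le] by blast
qed

lemma energy_leak_eq_0: "energy = 0" "leak = 0"
proof -
  have "(\<Sum>k<n. T k) = real n"
    using T_eq_1 by simp
  then show "energy = 0" "leak = 0"
    using energy_identity energy_nonneg leak_nonneg by linarith+
qed

lemma extremal_down_up: "v \<in> S \<Longrightarrow> down v + up v = 1"
proof -
  assume v: "v \<in> S"
  have "\<forall>v\<in>S. m v * (F v)\<^sup>2 * (1 - (down v + up v)) = 0"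
    using energy_leak_eq_0(2) fin m_pos down_up_le unfolding leak_def
    by (subst (asm) sum_nonneg_eq_0_iff) (auto intro!: mult_nonneg_nonneg simp: less_imp_le)
  then show ?thesis
    using v m_pos[OF v] F_pos[OF v] by auto
qed

lemma F_edge:
  assumes "u \<in> S" "v \<in> S" "h u = Suc (h v)" "q u v \<noteq> 0"
  shows "F u = F v"
proof -
  let ?e = "\<lambda>u v. m u * q u v * (F u - F v)\<^sup>2"
  have nn: "0 \<le> ?e u v" if "u \<in> S" "v \<in> S" for u v
    using m_pos q_nonneg that by (auto intro!: mult_nonneg_nonneg simp: less_imp_le)
  then have "0 \<le> (\<Sum>v | v \<in> S \<and> h u = Suc (h v). ?e u v)" if "u \<in> S" for u
    using that by (intro sum_nonneg) auto
  then have "(\<Sum>v | v \<in> S \<and> h u = Suc (h v). ?e u v) = 0"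
    using energy_leak_eq_0(1) fin assms(1) unfolding energy_def
    by (subst (asm) sum_nonneg_eq_0_iff) auto
  then have "?e u v = 0"
    using fin assms nn by (subst (asm) sum_nonneg_eq_0_iff) auto
  then show ?thesis
    using m_pos[OF assms(1)] assms(4) by simp
qed

text \<open>Since \<open>p v\<close> is positive, some transition with nonzero probability leads one
  layer down, and \<open>F\<close> does not change along it by \<open>F_edge\<close>. Iterating ends
  at \<open>y\<close>, the only vertex of the bottom layer.\<close>

lemma F_const: "v \<in> S \<Longrightarrow> F v = F y"
proof (induction "h v" arbitrary: v)
  case 0
  then show ?case using bottom by auto
next
  case (Suc k)
  have "(\<Sum>w | w \<in> S \<and> h w = k. q v w * p w) \<noteq> 0"
    using p_step[of v k] p_pos[of v] Suc by simp
  then obtain w where "w \<in> S" "h w = k" "q v w \<noteq> 0"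
    by (metis (mono_tags, lifting) mem_Collect_eq mult_zero_left sum.neutral)
  then show ?case
    using F_edge[of v w] Suc by auto
qed

text \<open>With \<open>F\<close> constant, \<open>F_step\<close> expresses \<open>down v\<close> as
  \<open>T k / c2 (Suc k)\<close>. Here \<open>T k\<close> is 1, and the layer of \<open>v\<close>
  is an inner one, of weight 2.\<close>

lemma extremal_down:
  assumes v: "v \<in> S" and "h v \<noteq> 0" "h v \<noteq> n"
  shows "down v = 1 / 2"
proof -
  obtain k where k: "h v = Suc k"
    using \<open>h v \<noteq> 0\<close> not0_implies_Suc by blast
  have kn: "k < n" and c2: "c2 (Suc k) = 2"
    using h_le[OF v] k assms by (auto simp: c2_def)
  have sp: "0 < s k" "0 < s (Suc k)" and ck: "0 < sqrt (c2 k)"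
    using s_pos kn c2_pos by auto
  have Fy: "0 < F y"
    using F_const[OF v] F_pos[OF v] by simp
  have "F y * down v = (\<Sum>w | w \<in> S \<and> h w = k. q v w * F w)"
    unfolding down_def sum_distrib_left using F_const k by (intro sum.cong) auto
  also have "\<dots> = sqrt (c2 k) / s k * p v"
    by (rule F_step[OF v k])
  also have "\<dots> = F v * (T k / c2 (Suc k))"
    using sp unfolding F_def T_def k c2 by (simp add: field_simps)
  also have "\<dots> = F y * (1 / 2)"
    using F_const[OF v] T_eq_1[OF kn] c2 by simp
  finally show ?thesis
    using Fy by simp
qed

end

end


section \<open>The simple random walk on the line and its reflection\<close>

lemma adj_line_edges:
  "(i, j) \<in> adj (line_edges n) \<longleftrightarrow> i \<le> n \<and> j \<le> n \<and> (j = Suc i \<or> i = Suc j)"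
proof
  assume "(i, j) \<in> adj (line_edges n)"
  then obtain k where "1 \<le> k" "k \<le> n" "{i, j} = {k - 1, k}"
    by (auto simp: adj_def line_edges_def)
  then show "i \<le> n \<and> j \<le> n \<and> (j = Suc i \<or> i = Suc j)"
    by (auto simp: doubleton_eq_iff)
next
  assume a: "i \<le> n \<and> j \<le> n \<and> (j = Suc i \<or> i = Suc j)"
  then have "max i j \<in> {1..n}" "{i, j} = {max i j - 1, max i j}"
    by (auto simp: max_def)
  then show "(i, j) \<in> adj (line_edges n)"
    unfolding adj_def line_edges_def by blast
qed

lemma simple_random_walk_line:
  assumes "0 < n" "i \<le> n" "j \<le> n"
  shows "simple_random_walk (line_edges n) i j =
    (if j = Suc i \<or> i = Suc j then if i = 0 \<or> i = n then 1 else 1 / 2 else 0)"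
proof -
  have nbrs: "adj (line_edges n) `` {i} = (if i = 0 then {1} else if i = n then {n - 1} else {i - 1, Suc i})"
    using assms by (auto simp: adj_line_edges)
  have "card (adj (line_edges n) `` {i}) = (if i = 0 \<or> i = n then 1 else 2)"
    unfolding nbrs by auto
  then show ?thesis
    using assms by (auto simp: simple_random_walk_def adj_line_edges)
qed

text \<open>Compose the projection with the reflection \<open>i -> n - i\<close>, which preserves
  the walk on the line and exchanges its ends.\<close>

lemma projects_to_line_swap:
  assumes "0 < n" "projects_to_line V q x y n"
  shows "projects_to_line V q y x n"
proof -
  obtain f where im: "f ` V = {0..n}"
    and fib: "\<And>v j. v \<in> V \<Longrightarrow> j \<le> n \<Longrightarrow>
        (\<Sum>\<^sub>\<infinity>w\<in>{w \<in> V. f w = j}. q v w) = simple_random_walk (line_edges n) (f v) j"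
    and ends: "{v \<in> V. f v = 0} = {x}" "{v \<in> V. f v = n} = {y}"
    using assms(2) unfolding projects_to_line_def chain_projection_def line_verts_def by auto
  have le: "f v \<le> n" if "v \<in> V" for v
    using im that by auto
  \<comment> \<open>The subtractions are not truncated, as \<open>f w\<close> and \<open>j\<close>
    are at most \<open>n\<close>.\<close>
  have fib': "{w \<in> V. n - f w = j} = {w \<in> V. f w = n - j}" if "j \<le> n" for j
    using le that by force
  have "(\<lambda>v. n - f v) ` V = (\<lambda>i. n - i) ` {0..n}"
    unfolding im[symmetric] image_image ..
  also have "\<dots> = {0..n}"
  proof
    show "{0..n} \<subseteq> (\<lambda>i. n - i) ` {0..n}"
    proof
      fix j assume "j \<in> {0..n}"
      then show "j \<in> (\<lambda>i. n - i) ` {0..n}"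
        by (intro image_eqI[of _ _ "n - j"]) auto
    qed
  qed auto
  finally have "(\<lambda>v. n - f v) ` V = {0..n}" .
  moreover have "(\<Sum>\<^sub>\<infinity>w\<in>{w \<in> V. n - f w = j}. q v w)
      = simple_random_walk (line_edges n) (n - f v) j" if "v \<in> V" "j \<le> n" for v j
  proof -
    have "(\<Sum>\<^sub>\<infinity>w\<in>{w \<in> V. n - f w = j}. q v w)
        = simple_random_walk (line_edges n) (f v) (n - j)"
      using that fib[OF that(1), of "n - j"] by (simp only: fib' diff_le_self)
    also have "\<dots> = simple_random_walk (line_edges n) (n - f v) j"
    proof -
      have "n - j = Suc (f v) \<or> f v = Suc (n - j) \<longleftrightarrow> j = Suc (n - f v) \<or> n - f v = Suc j"
        "f v = 0 \<or> f v = n \<longleftrightarrow> n - f v = 0 \<or> n - f v = n"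
        using le[OF that(1)] that(2) by linarith+
      then show ?thesis
        using le[OF that(1)] that(2) \<open>0 < n\<close> by (simp only: simple_random_walk_line diff_le_self)
    qed
    finally show ?thesis .
  qed
  moreover have "{v \<in> V. n - f v = 0} = {y}" "{v \<in> V. n - f v = n} = {x}"
    using fib'[of 0] fib'[of n] ends by auto
  ultimately show ?thesis
    unfolding projects_to_line_def chain_projection_def line_verts_def
    by (intro exI[of _ "\<lambda>v. n - f v"] conjI ballI) (simp_all only: atLeastAtMost_iff)
qed

section \<open>Transition probabilities and distances for a reversible nearest neighbour
  chain\<close>

locale reversible_walk =
  fixes V :: "'a set" and E :: "'a set set" and q :: "'a \<Rightarrow> 'a \<Rightarrow> real" and m :: "'a \<Rightarrow> real"
  assumes simple: "simple_graph V E"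
    and locally_finite: "locally_finite_graph V E"
    and connected: "connected_graph V E"
    and markov: "markov_chain V q"
    and nearest: "nearest_neighbour V E q"
    and m_pos: "v \<in> V \<Longrightarrow> 0 < m v"
    and m_rev: "u \<in> V \<Longrightarrow> v \<in> V \<Longrightarrow> m u * q u v = m v * q v u"
begin

abbreviation "nbrs v \<equiv> adj E `` {v}"
abbreviation "D \<equiv> graph_dist E"
abbreviation "P \<equiv> nstep V q"

lemma adj_V: "(u, v) \<in> adj E \<Longrightarrow> u \<in> V \<and> v \<in> V"
  using simple unfolding simple_graph_def adj_def by (fastforce simp: doubleton_eq_iff)

lemma adj_sym: "(u, v) \<in> adj E \<longleftrightarrow> (v, u) \<in> adj E"
  by (simp add: adj_def insert_commute)

lemma nbrs_V: "nbrs v \<subseteq> V"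
  using adj_V by auto

lemma finite_nbrs: "v \<in> V \<Longrightarrow> finite (nbrs v)"
  using locally_finite by (simp add: locally_finite_graph_def)

lemma q_nonneg: "u \<in> V \<Longrightarrow> v \<in> V \<Longrightarrow> 0 \<le> q u v"
  using markov by (simp add: markov_chain_def)

lemma q_pos: "u \<in> V \<Longrightarrow> v \<in> V \<Longrightarrow> 0 < q u v \<longleftrightarrow> v \<in> nbrs u"
  using nearest by (simp add: nearest_neighbour_def)

lemma q_zero: "u \<in> V \<Longrightarrow> v \<in> V \<Longrightarrow> v \<notin> nbrs u \<Longrightarrow> q u v = 0"
  using q_pos[of u v] q_nonneg[of u v] by auto

text \<open>The kernel vanishes off the neighbours of \<open>v\<close>, of which there are finitely
  many; so infinite sums against it become finite.\<close>

lemma infsum_nbrs: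
  assumes "v \<in> V" "A \<subseteq> V"
  shows "(\<Sum>\<^sub>\<infinity>w\<in>A. q v w * g w) = (\<Sum>w\<in>nbrs v \<inter> A. q v w * g w)"
proof -
  have "(\<Sum>\<^sub>\<infinity>w\<in>A. q v w * g w) = (\<Sum>\<^sub>\<infinity>w\<in>nbrs v \<inter> A. q v w * g w)"
    using assms q_zero by (intro infsum_cong_neutral) auto
  then show ?thesis
    using finite_nbrs[OF assms(1)] by simp
qed

lemma infsum_q:
  "v \<in> V \<Longrightarrow> A \<subseteq> V \<Longrightarrow> (\<Sum>\<^sub>\<infinity>w\<in>A. q v w) = (\<Sum>w\<in>nbrs v \<inter> A. q v w)"
  using infsum_nbrs[of v A "\<lambda>_. 1"] by simp

lemma infsum_q_cong:
  assumes "v \<in> V" "\<And>w. w \<in> nbrs v \<Longrightarrow> Q w \<longleftrightarrow> R w"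
  shows "(\<Sum>\<^sub>\<infinity>w\<in>{w \<in> V. Q w}. q v w) = (\<Sum>\<^sub>\<infinity>w\<in>{w \<in> V. R w}. q v w)"
proof -
  have "nbrs v \<inter> {w \<in> V. Q w} = nbrs v \<inter> {w \<in> V. R w}"
    using assms(2) by blast
  then show ?thesis
    using infsum_q[OF assms(1), of "{w \<in> V. Q w}"] infsum_q[OF assms(1), of "{w \<in> V. R w}"]
    by simp
qed

lemma sum_nbrs: "v \<in> V \<Longrightarrow> (\<Sum>w\<in>nbrs v. q v w) = 1"
proof -
  assume v: "v \<in> V"
  then have "(\<Sum>\<^sub>\<infinity>w\<in>V. q v w) = 1"
    using markov by (auto simp: markov_chain_def intro: infsumI)
  then show ?thesis
    using infsum_q[OF v order.refl] nbrs_V[of v] by (simp add: inf.absorb1)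
qed

lemma sum_q_le:
  assumes "v \<in> V" "finite A" "A \<subseteq> V"
  shows "(\<Sum>w\<in>A. q v w) \<le> 1"
proof -
  have "(\<Sum>w\<in>A. q v w) = (\<Sum>w\<in>nbrs v \<inter> A. q v w)"
    using infsum_q[of v A] assms by simp
  also have "\<dots> \<le> (\<Sum>w\<in>nbrs v. q v w)"
    using finite_nbrs nbrs_V[of v] q_nonneg assms by (intro sum_mono2) auto
  finally show ?thesis
    using sum_nbrs assms by simp
qed

text \<open>A neighbour outside \<open>A\<close> has positive probability, which would be missing
  from the total mass 1. This turns mass conditions into statements about edges.\<close>

lemma nbrs_subset_if_sum_eq_1:
  assumes v: "v \<in> V" and A: "A \<subseteq> V" "(\<Sum>\<^sub>\<infinity>w\<in>A. q v w) = 1"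
  shows "nbrs v \<subseteq> A"
proof (rule ccontr)
  assume "\<not> nbrs v \<subseteq> A"
  then obtain u where u: "u \<in> nbrs v" "u \<notin> A" by blast
  have "(\<Sum>w\<in>nbrs v \<inter> A. q v w) < (\<Sum>w\<in>nbrs v. q v w)"
    using finite_nbrs[OF v] nbrs_V[of v] u q_pos[of v u] q_nonneg[of v] v
    by (intro sum_strict_mono2[of _ _ u]) auto
  then show False
    using infsum_q[OF v A(1)] A(2) sum_nbrs[OF v] by simp
qed

lemma walk_sym: "(u, v) \<in> adj E ^^ k \<Longrightarrow> (v, u) \<in> adj E ^^ k"
proof (induction k arbitrary: v)
  case (Suc k)
  then obtain w where "(u, w) \<in> adj E ^^ k" "(w, v) \<in> adj E" by auto
  then show ?case
    using Suc.IH adj_sym by (metis relpow_Suc_I2)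
qed simp

lemma dist_walk: "u \<in> V \<Longrightarrow> v \<in> V \<Longrightarrow> (u, v) \<in> adj E ^^ D u v"
  using connected unfolding connected_graph_def graph_dist_def
  by (metis LeastI rtrancl_power)

lemma dist_le: "(u, v) \<in> adj E ^^ k \<Longrightarrow> D u v \<le> k"
  by (simp add: graph_dist_def Least_le)

lemma dist_sym: "u \<in> V \<Longrightarrow> v \<in> V \<Longrightarrow> D u v = D v u"
  by (meson dist_le dist_walk walk_sym order.antisym)

lemma dist_self [simp]: "D u u = 0"
  using dist_le[of u u 0] by simp

lemma dist_eq_0: "u \<in> V \<Longrightarrow> v \<in> V \<Longrightarrow> D u v = 0 \<longleftrightarrow> u = v"
  using dist_walk[of u v] by auto

lemma dist_triangle: "u \<in> V \<Longrightarrow> v \<in> V \<Longrightarrow> w \<in> V \<Longrightarrow> D u w \<le> D u v + D v w"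
  by (intro dist_le) (auto simp: relpow_add intro: relcompI dist_walk)

lemma dist_nbr: "w \<in> nbrs v \<Longrightarrow> D v w \<le> 1"
  using dist_le[of v w 1] by simp

lemma dist_nbr_le: "u \<in> V \<Longrightarrow> w \<in> nbrs v \<Longrightarrow> D u w \<le> Suc (D u v)"
  using dist_triangle[of u v w] dist_nbr[of w v] adj_V[of v w] by auto

lemma dist_nbr_ge: "u \<in> V \<Longrightarrow> w \<in> nbrs v \<Longrightarrow> D u v \<le> Suc (D u w)"
  using dist_nbr_le[of u v w] adj_sym by auto

lemma dist_Suc_nbr:
  assumes "u \<in> V" "v \<in> V" "D u v = Suc k"
  obtains w where "w \<in> nbrs v" "D u w = k"
proof -
  obtain w where w: "(u, w) \<in> adj E ^^ k" "(w, v) \<in> adj E"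
    using dist_walk[OF assms(1,2)] assms(3) by auto
  have "w \<in> nbrs v"
    using w adj_sym by auto
  moreover have "D u w = k"
    using dist_le[OF w(1)] dist_nbr_ge[OF assms(1) calculation] assms(3) by simp
  ultimately show ?thesis using that by blast
qed

text \<open>A larger ball adds only neighbours of the smaller one, finitely many by local
  finiteness.\<close>

lemma finite_ball: "u \<in> V \<Longrightarrow> finite {v \<in> V. D u v \<le> k}"
proof (induction k)
  case 0
  then show ?case
    by (auto simp: dist_eq_0 intro: finite_subset[of _ "{u}"])
next
  case (Suc k)
  have "{v \<in> V. D u v \<le> Suc k} \<subseteq> {v \<in> V. D u v \<le> k} \<union> (\<Union>v\<in>{v \<in> V. D u v \<le> k}. nbrs v)"
  proof
    fix v assume "v \<in> {v \<in> V. D u v \<le> Suc k}"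
    then have v: "v \<in> V" "D u v \<le> Suc k" by auto
    show "v \<in> {v \<in> V. D u v \<le> k} \<union> (\<Union>v\<in>{v \<in> V. D u v \<le> k}. nbrs v)"
    proof (cases "D u v \<le> k")
      case False
      then have "D u v = Suc k" using v by simp
      then obtain w where "w \<in> nbrs v" "D u w = k"
        using dist_Suc_nbr Suc.prems v by blast
      then show ?thesis
        using adj_sym[of v w] adj_V[of v w] by auto
    qed (use v in auto)
  qed
  then show ?case
    using Suc finite_nbrs by (auto intro: finite_subset)
qed

lemma connected_induct:
  assumes "u \<in> V" "v \<in> V" "u \<in> S" "\<And>v w. v \<in> S \<Longrightarrow> w \<in> nbrs v \<Longrightarrow> w \<in> S"
  shows "v \<in> S"
proof -
  have "(u, v) \<in> (adj E)\<^sup>*"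
    using connected assms by (simp add: connected_graph_def)
  then show ?thesis
    by (induction rule: rtrancl_induct) (use assms in auto)
qed

lemma nstep_Suc: "u \<in> V \<Longrightarrow> P (Suc k) u v = (\<Sum>w\<in>nbrs u. q u w * P k w v)"
  using infsum_nbrs[of u V "\<lambda>w. P k w v"] nbrs_V[of u] by (simp add: inf.absorb1)

declare nstep.simps(2) [simp del]

text \<open>Splits off the last step instead of the first; time reversal in \<open>nstep_rev\<close>
  exchanges the two.\<close>

lemma nstep_Suc_right:
  "u \<in> V \<Longrightarrow> v \<in> V \<Longrightarrow> P (Suc k) u v = (\<Sum>w\<in>nbrs v. P k u w * q w v)"
proof (induction k arbitrary: u)
  case 0
  have "P (Suc 0) u v = (if v \<in> nbrs u then q u v else 0)"
    using 0 finite_nbrs[of u] by (simp add: nstep_Suc if_distrib sum.delta cong: if_cong)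
  moreover have "(\<Sum>w\<in>nbrs v. P 0 u w * q w v) = (if u \<in> nbrs v then q u v else 0)"
    using 0 finite_nbrs[of v] by (simp add: if_distrib if_distribR sum.delta' cong: if_cong)
  ultimately show ?case
    using adj_sym by auto
next
  case (Suc k)
  have "P (Suc (Suc k)) u v = (\<Sum>w\<in>nbrs u. q u w * (\<Sum>z\<in>nbrs v. P k w z * q z v))"
    unfolding nstep_Suc[OF Suc.prems(1), of "Suc k"]
    using Suc nbrs_V[of u] by (intro sum.cong refl) (metis subsetD)
  also have "\<dots> = (\<Sum>z\<in>nbrs v. (\<Sum>w\<in>nbrs u. q u w * P k w z) * q z v)"
    unfolding sum_distrib_left sum_distrib_right
    by (subst sum.swap) (simp add: mult_ac)
  also have "\<dots> = (\<Sum>z\<in>nbrs v. P (Suc k) u z * q z v)"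
    using Suc.prems by (simp add: nstep_Suc)
  finally show ?case .
qed

lemma nstep_rev: "u \<in> V \<Longrightarrow> v \<in> V \<Longrightarrow> m u * P k u v = m v * P k v u"
proof (induction k arbitrary: u)
  case (Suc k)
  have "m u * P (Suc k) u v = (\<Sum>w\<in>nbrs u. (m u * q u w) * P k w v)"
    using Suc.prems by (simp add: nstep_Suc sum_distrib_left mult_ac)
  also have "\<dots> = (\<Sum>w\<in>nbrs u. m v * (P k v w * q w u))"
  proof (intro sum.cong refl)
    fix w assume "w \<in> nbrs u"
    then have w: "w \<in> V" using nbrs_V by blast
    have "(m u * q u w) * P k w v = q w u * (m w * P k w v)"
      using m_rev[OF Suc.prems(1) w] by simp
    then show "(m u * q u w) * P k w v = m v * (P k v w * q w u)"
      using Suc.IH[OF w Suc.prems(2)] by simp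
  qed
  also have "\<dots> = m v * P (Suc k) v u"
    using Suc.prems by (simp add: nstep_Suc_right sum_distrib_left)
  finally show ?case .
qed simp

lemma nstep_eq_0: "u \<in> V \<Longrightarrow> v \<in> V \<Longrightarrow> k < D v u \<Longrightarrow> P k u v = 0"
proof (induction k arbitrary: u)
  case (Suc k)
  have "P k w v = 0" if "w \<in> nbrs u" for w
    using Suc dist_nbr_ge[OF Suc.prems(2) that] that nbrs_V[of u] by auto
  then show ?case
    using Suc.prems by (simp add: nstep_Suc)
qed auto

text \<open>A neighbour of \<open>u\<close> has distance at least \<open>k\<close> from
  \<open>v\<close>, and one at a larger distance cannot reach \<open>v\<close> in \<open>k\<close>
  steps.\<close>

lemma nstep_geodesic_step:
  assumes "u \<in> V" "v \<in> V" "D v u = Suc k"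
  shows "P (Suc k) u v = (\<Sum>w | w \<in> nbrs u \<and> D v w = k. q u w * P k w v)"
  unfolding nstep_Suc[OF assms(1)]
proof (rule sum.mono_neutral_right)
  show "\<forall>w\<in>nbrs u - {w \<in> nbrs u. D v w = k}. q u w * P k w v = 0"
  proof
    fix w assume w: "w \<in> nbrs u - {w \<in> nbrs u. D v w = k}"
    then have "k < D v w"
      using dist_nbr_ge[OF assms(2), of w u] assms(3) by auto
    then show "q u w * P k w v = 0"
      using nstep_eq_0[of w v k] w nbrs_V[of u] assms by auto
  qed
qed (use finite_nbrs assms in auto)

lemma nstep_dist_pos: "u \<in> V \<Longrightarrow> v \<in> V \<Longrightarrow> D v u = k \<Longrightarrow> 0 < P k u v"
proof (induction k arbitrary: u)
  case 0
  then show ?case by (simp add: dist_eq_0)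
next
  case (Suc k)
  obtain w where w: "w \<in> nbrs u" "D v w = k"
    using dist_Suc_nbr[OF Suc.prems(2,1,3)] by blast
  have "0 < q u w * P k w v" if "w \<in> nbrs u" "D v w = k" for w
    using that Suc.IH[of w] Suc.prems nbrs_V[of u] q_pos[of u w] by auto
  then show ?case
    unfolding nstep_geodesic_step[OF Suc.prems]
    using finite_nbrs[OF Suc.prems(1)] w
    by (intro sum_pos) (auto intro: finite_subset[of _ "nbrs u"])
qed

section \<open>Chains that project to the line\<close>

text \<open>To get from end to end in \<open>n\<close> steps, the image must move up every time. It
  does so with probability 1 at the first step and 1/2 at each of the other
  \<open>n - 1\<close>.\<close>

lemma projects_imp_nstep:
  assumes n: "0 < n" and x: "x \<in> V" and "projects_to_line V q x y n"
  shows "P n x y = 2 * (1 / 2) ^ n"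
proof -
  obtain f where im: "f ` V = {0..n}"
    and fib: "\<And>v j. v \<in> V \<Longrightarrow> j \<le> n \<Longrightarrow>
        (\<Sum>\<^sub>\<infinity>w\<in>{w \<in> V. f w = j}. q v w) = simple_random_walk (line_edges n) (f v) j"
    and ends: "{v \<in> V. f v = 0} = {x}" "{v \<in> V. f v = n} = {y}"
    using assms(3) unfolding projects_to_line_def chain_projection_def line_verts_def by auto
  have le: "f v \<le> n" if "v \<in> V" for v
    using im that by auto
  \<comment> \<open>Otherwise the line walk gives the fibre of \<open>w\<close> probability 0,
    although \<open>w\<close> itself has positive probability.\<close>
  have step: "f w = Suc (f v) \<or> f v = Suc (f w)" if v: "v \<in> V" and w: "w \<in> nbrs v" for v w
  proof (rule ccontr)
    assume not: "\<not> ?thesis"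
    have wV: "w \<in> V" using w nbrs_V by blast
    have "(\<Sum>u\<in>nbrs v \<inter> {u \<in> V. f u = f w}. q v u) = (\<Sum>\<^sub>\<infinity>u\<in>{u \<in> V. f u = f w}. q v u)"
      using v by (intro infsum_q[symmetric]) auto
    also have "\<dots> = 0"
      unfolding fib[OF v le[OF wV]] simple_random_walk_line[OF n le[OF v] le[OF wV]]
      using not by simp
    finally have "(\<Sum>u\<in>nbrs v \<inter> {u \<in> V. f u = f w}. q v u) = 0" .
    moreover have "0 < (\<Sum>u\<in>nbrs v \<inter> {u \<in> V. f u = f w}. q v u)"
      using w wV v finite_nbrs[OF v] q_pos[OF v] by (intro sum_pos) auto
    ultimately show False by simp
  qed
  have zero: "P k v y = 0" if "v \<in> V" "k + f v < n" for k v
    using that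
  proof (induction k arbitrary: v)
    case 0
    then show ?case using ends by auto
  next
    case (Suc k)
    have "P k w y = 0" if "w \<in> nbrs v" for w
    proof -
      have "w \<in> V" using that nbrs_V by blast
      then show ?thesis
        using Suc.IH[of w] Suc.prems(2) step[OF Suc.prems(1) that] by linarith
    qed
    then show ?case
      using Suc.prems by (simp add: nstep_Suc)
  qed
  \<comment> \<open>The factor 2 accounts for the forced step away from the end 0. After a downward
    step too little time is left by \<open>zero\<close>, so that only the fibre above
    \<open>v\<close> contributes.\<close>
  have main: "P k v y = (if f v = 0 then 2 else 1) * (1 / 2) ^ k" if "v \<in> V" "k + f v = n" for k v
    using that
  proof (induction k arbitrary: v)
    case 0
    then show ?case using ends n by auto
  next
    case (Suc k)
    note v = \<open>v \<in> V\<close>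
    have "P k w y = (if f w = Suc (f v) then (1 / 2) ^ k else 0)" if w: "w \<in> nbrs v" for w
    proof -
      have wV: "w \<in> V" using w nbrs_V by blast
      from step[OF v w] show ?thesis
      proof
        assume "f w = Suc (f v)"
        then show ?thesis
          using Suc.IH[OF wV] Suc.prems(2) by simp
      next
        assume "f v = Suc (f w)"
        then show ?thesis
          using zero[OF wV, of k] Suc.prems(2) by simp
      qed
    qed
    then have "P (Suc k) v y = (\<Sum>w\<in>nbrs v. if f w = Suc (f v) then q v w * (1 / 2) ^ k else 0)"
      using v by (auto simp: nstep_Suc intro!: sum.cong)
    also have "\<dots> = (\<Sum>w | w \<in> nbrs v \<and> f w = Suc (f v). q v w * (1 / 2) ^ k)"
      by (rule sum.inter_filter[OF finite_nbrs[OF v], symmetric])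
    also have "\<dots> = (\<Sum>w\<in>nbrs v \<inter> {w \<in> V. f w = Suc (f v)}. q v w * (1 / 2) ^ k)"
      using nbrs_V[of v] by (intro sum.cong) blast+
    also have "\<dots> = (\<Sum>w\<in>nbrs v \<inter> {w \<in> V. f w = Suc (f v)}. q v w) * (1 / 2) ^ k"
      by (simp add: sum_distrib_right)
    also have "(\<Sum>w\<in>nbrs v \<inter> {w \<in> V. f w = Suc (f v)}. q v w)
        = (\<Sum>\<^sub>\<infinity>w\<in>{w \<in> V. f w = Suc (f v)}. q v w)"
      using v by (intro infsum_q[symmetric]) auto
    also have "\<dots> = simple_random_walk (line_edges n) (f v) (Suc (f v))"
      using Suc.prems(2) by (intro fib[OF v]) simp
    also have "\<dots> = (if f v = 0 then 1 else 1 / 2)"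
      using Suc.prems(2) by (subst simple_random_walk_line[OF n]) auto
    finally show ?case by simp
  qed
  have "f x = 0" using ends by auto
  then show ?thesis
    using main[of x n] x by simp
qed

lemma projects_imp_equality:
  assumes n: "0 < n" and "x \<in> V" "y \<in> V" and proj: "projects_to_line V q x y n"
  shows "P n x y * P n y x = 4 powi (1 - int n)"
proof -
  have "P n x y * P n y x = (2 * (1 / 2) ^ n) * (2 * (1 / 2) ^ n)"
    using projects_imp_nstep[OF n] projects_to_line_swap[OF n proj] assms by simp
  also have "\<dots> = 4 * ((1 / 2) * (1 / 2)) ^ n"
    by (simp only: power_mult_distrib)
  also have "\<dots> = 4 powi (1 - int n)"
    by (simp add: power_int_diff power_divide)
  finally show ?thesis .
qed

end

section \<open>The geodesics between two vertices\<close>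

locale reversible_walk_pair = reversible_walk V E q m
  for V :: "'a set" and E :: "'a set set" and q :: "'a \<Rightarrow> 'a \<Rightarrow> real" and m :: "'a \<Rightarrow> real" +
  fixes x y :: 'a and n :: nat
  assumes x: "x \<in> V" and y: "y \<in> V" and xy: "x \<noteq> y" and n: "n = graph_dist E x y"
begin

definition S :: "'a set" where
  "S = {v \<in> V. D x v + D y v = n}"

lemma dist_xy: "D x y = n" "D y x = n"
  using n dist_sym[OF x y] by simp_all

lemma n_pos: "0 < n"
  using dist_eq_0[OF x y] xy dist_xy by simp

lemma S_V: "v \<in> S \<Longrightarrow> v \<in> V"
  by (simp add: S_def)

lemma finite_S: "finite S"
  using finite_ball[OF x, of n] by (rule finite_subset[rotated]) (auto simp: S_def)

lemma x_S: "x \<in> S" and y_S: "y \<in> S"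
  using x y dist_xy by (auto simp: S_def)

text \<open>A step towards \<open>y\<close> increases the distance from \<open>x\<close> by at most
  1, so the two distances still add up to at most \<open>n\<close>; the triangle inequality gives
  the converse.\<close>

lemma S_nbr:
  assumes "v \<in> S" "D y v = Suc k"
  shows "{w \<in> nbrs v. D y w = k} \<subseteq> {w \<in> S. D y w = k}"
proof
  fix w assume w: "w \<in> {w \<in> nbrs v. D y w = k}"
  then have wV: "w \<in> V" using nbrs_V by blast
  have "D x w \<le> Suc (D x v)"
    using w dist_nbr_le[OF x] by blast
  moreover have "n \<le> D x w + D y w"
    using dist_triangle[OF x wV y] dist_sym[OF wV y] dist_xy by simp
  ultimately show "w \<in> {w \<in> S. D y w = k}"
    using w wV assms by (auto simp: S_def)
qed

sublocale layer: layered_chain S "D y" q m "\<lambda>v. P (D y v) v y" n x y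
proof
  show "D y v \<le> n" if "v \<in> S" for v
    using that by (simp add: S_def)
  show "{v \<in> S. D y v = 0} = {y}"
    using y_S dist_eq_0[OF y S_V] by auto
  show "{v \<in> S. D y v = n} = {x}"
    using x dist_eq_0[OF x] dist_xy by (auto simp: S_def)
  show "(\<Sum>w\<in>S. q v w) \<le> 1" if "v \<in> S" for v
    using sum_q_le[OF S_V[OF that] finite_S] S_V by blast
  show "P (D y v) v y = (\<Sum>w | w \<in> S \<and> D y w = k. q v w * P (D y w) w y)"
    if v: "v \<in> S" and k: "D y v = Suc k" for v k
  proof -
    have "P (D y v) v y = (\<Sum>w | w \<in> nbrs v \<and> D y w = k. q v w * P k w y)"
      using nstep_geodesic_step[OF S_V[OF v] y k] k by simp
    \<comment> \<open>By \<open>S_nbr\<close> no neighbour is lost, and the additional vertices of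
      \<open>S\<close> have transition probability 0.\<close>
    also have "\<dots> = (\<Sum>w | w \<in> S \<and> D y w = k. q v w * P k w y)"
      using S_nbr[OF v k] finite_S q_zero S_V v
      by (intro sum.mono_neutral_left) auto
    finally show ?thesis by simp
  qed
qed (use S_V finite_S n_pos q_nonneg m_pos m_rev nstep_dist_pos y in auto)

text \<open>Reversibility of the \<open>n\<close>-step kernel trades one factor
  \<open>m x * P n x y\<close> for \<open>m y * P n y x\<close>.\<close>

lemma layer_weight: "m x * (P (D y x) x y)\<^sup>2 / m y = P n x y * P n y x"
proof -
  have "m x * (P n x y)\<^sup>2 = m y * (P n x y * P n y x)"
    using nstep_rev[OF x y, of n] by (simp add: power2_eq_square)
  then show ?thesis
    using m_pos[OF y] dist_xy by (simp add: field_simps)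
qed

lemma powi_eq: "(4::real) powi (1 - int n) = 1 / 4 ^ (n - 1)"
proof -
  have "1 - int n = - int (n - 1)"
    using n_pos by simp
  then show ?thesis
    by (simp only: power_int_minus power_int_of_nat inverse_eq_divide)
qed

lemma return_le: "P n x y * P n y x \<le> 4 powi (1 - int n)"
  using layer.weight_le unfolding layer_weight powi_eq by (simp add: field_simps)

abbreviation "toward u v \<equiv> (\<Sum>\<^sub>\<infinity>w\<in>{w \<in> V. D u w < D u v}. q v w)"

text \<open>Equality leaves only transitions within \<open>S\<close> between consecutive layers. So
  \<open>S\<close> is closed under adjacency and is all of \<open>V\<close> by connectedness; moving
  down a layer then means approaching \<open>y\<close>, and moving up means approaching
  \<open>x\<close>.\<close>

lemma equality_imp_toward:
  assumes "P n x y * P n y x = 4 powi (1 - int n)"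
  shows "toward y x = 1" "toward x y = 1"
    and "\<And>v. v \<in> V - {x, y} \<Longrightarrow> toward x v = 1 / 2 \<and> toward y v = 1 / 2"
proof -
  have ext: "4 ^ (n - 1) * (m x * (P (D y x) x y)\<^sup>2 / m y) = 1"
    using assms unfolding layer_weight powi_eq by (simp add: field_simps)
  note du = layer.extremal_down_up[OF ext] and half = layer.extremal_down[OF ext]
  have nbr: "w \<in> S \<and> (D y v = Suc (D y w) \<or> D y w = Suc (D y v))"
    if v: "v \<in> S" and w: "w \<in> nbrs v" for v w
  proof -
    let ?A = "{w \<in> S. D y v = Suc (D y w)} \<union> {w \<in> S. D y w = Suc (D y v)}"
    have "layer.down v + layer.up v = (\<Sum>w\<in>?A. q v w)"
      unfolding layer.down_def layer.up_def
      using finite_S by (intro sum.union_disjoint[symmetric]) auto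
    then have "(\<Sum>\<^sub>\<infinity>w\<in>?A. q v w) = 1"
      using du[OF v] finite_S by simp
    then have "nbrs v \<subseteq> ?A"
      using S_V v by (intro nbrs_subset_if_sum_eq_1) auto
    then show ?thesis using w by blast
  qed
  have all: "v \<in> S" if "v \<in> V" for v
    using connected_induct[OF x that x_S] nbr by blast
  have lev: "D x v + D y v = n" if "v \<in> V" for v
    using all[OF that] by (simp add: S_def)
  have S_eq: "S = V"
    using all S_V by blast
  have finite_V: "finite V"
    using finite_S by (simp only: S_eq)
  have down: "toward y v = layer.down v" if v: "v \<in> V" for v
  proof -
    have "toward y v = (\<Sum>\<^sub>\<infinity>w\<in>{w \<in> V. D y v = Suc (D y w)}. q v w)"
    proof (rule infsum_q_cong[OF v])
      fix w assume "w \<in> nbrs v"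
      then show "D y w < D y v \<longleftrightarrow> D y v = Suc (D y w)"
        using nbr[OF all[OF v]] by fastforce
    qed
    then show ?thesis
      unfolding layer.down_def by (simp add: S_eq finite_V)
  qed
  have up: "toward x v = layer.up v" if v: "v \<in> V" for v
  proof -
    have "toward x v = (\<Sum>\<^sub>\<infinity>w\<in>{w \<in> V. D y w = Suc (D y v)}. q v w)"
    proof (rule infsum_q_cong[OF v])
      fix w assume w: "w \<in> nbrs v"
      then have "w \<in> V" using nbrs_V by blast
      then show "D x w < D x v \<longleftrightarrow> D y w = Suc (D y v)"
        using nbr[OF all[OF v] w] lev[OF v] lev[of w] by linarith
    qed
    then show ?thesis
      unfolding layer.up_def by (simp add: S_eq finite_V)
  qed
  \<comment> \<open>No vertex is closer to \<open>x\<close> than \<open>x\<close> itself, and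
    likewise for \<open>y\<close>.\<close>
  have "layer.up x = 0" "layer.down y = 0"
    using up[OF x] down[OF y] by simp_all
  then show "toward y x = 1" "toward x y = 1"
    using du[OF x_S] du[OF y_S] up[OF y] down[OF x] by simp_all
  show "toward x v = 1 / 2 \<and> toward y v = 1 / 2" if v: "v \<in> V - {x, y}" for v
  proof -
    have "D y v \<noteq> 0" "D y v \<noteq> n"
      using v dist_eq_0[OF y, of v] dist_eq_0[OF x, of v] lev[of v] by auto
    moreover have "v \<in> V" "v \<in> S"
      using v all by auto
    ultimately show ?thesis
      using half[of v] du[of v] up[of v] down[of v] by simp
  qed
qed

text \<open>The projection is the distance from \<open>x\<close>. The mass conditions force each
  step from a geodesic vertex to approach \<open>x\<close> or \<open>y\<close>, so that
  \<open>S\<close> is closed under adjacency and equals \<open>V\<close>.\<close>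

lemma toward_imp_projects:
  assumes "toward y x = 1" "toward x y = 1"
    and half: "\<And>v. v \<in> V - {x, y} \<Longrightarrow> toward x v = 1 / 2 \<and> toward y v = 1 / 2"
  shows "projects_to_line V q x y n"
proof -
  have sub: "n \<le> D x w + D y w" if "w \<in> V" for w
    using dist_triangle[OF x that y] dist_sym[OF that y] dist_xy by simp
  have closer: "D y w < D y v \<or> D x w < D x v" if v: "v \<in> S" and w: "w \<in> nbrs v" for v w
  proof -
    have vV: "v \<in> V" by (rule S_V[OF v])
    consider "v = x" | "v = y" | "v \<in> V - {x, y}"
      using vV by blast
    then show ?thesis
    proof cases
      case 1
      then show ?thesis
        using nbrs_subset_if_sum_eq_1[OF x _ assms(1)] w by auto
    next
      case 2
      then show ?thesis
        using nbrs_subset_if_sum_eq_1[OF y _ assms(2)] w by auto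
    next
      case 3
      let ?X = "nbrs v \<inter> {w \<in> V. D x w < D x v}" and ?Y = "nbrs v \<inter> {w \<in> V. D y w < D y v}"
      \<comment> \<open>A neighbour closer to both ends would join them by a path shorter than
        \<open>n\<close>. The two sets of mass 1/2 are thus disjoint and exhaust the
        neighbours.\<close>
      have "?X \<inter> ?Y = {}"
      proof (intro equals0I)
        fix u assume u: "u \<in> ?X \<inter> ?Y"
        have "D x v + D y v = n" using v by (simp add: S_def)
        then show False
          using sub[of u] u by simp
      qed
      then have "(\<Sum>w\<in>?X \<union> ?Y. q v w) = (\<Sum>w\<in>?X. q v w) + (\<Sum>w\<in>?Y. q v w)"
        using finite_nbrs[OF vV] by (intro sum.union_disjoint) auto
      also have "\<dots> = 1"
        using half[OF 3] vV by (simp add: infsum_q)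
      finally have "(\<Sum>\<^sub>\<infinity>w\<in>?X \<union> ?Y. q v w) = 1"
        using finite_nbrs[OF vV] by simp
      then have "nbrs v \<subseteq> ?X \<union> ?Y"
        using vV by (intro nbrs_subset_if_sum_eq_1) auto
      then show ?thesis using w by auto
    qed
  qed
  have S_step: "w \<in> S" if v: "v \<in> S" and w: "w \<in> nbrs v" for v w
  proof -
    have "w \<in> V" using w nbrs_V by blast
    moreover have "D x v + D y v = n" using v by (simp add: S_def)
    \<comment> \<open>Approaching one end costs at most 1 in the distance from the other, and the
      sum cannot drop below \<open>n\<close>.\<close>
    ultimately have "D x w + D y w = n"
      using closer[OF v w] sub[of w] dist_nbr_le[OF x w] dist_nbr_le[OF y w] by linarith
    then show ?thesis
      using \<open>w \<in> V\<close> by (simp add: S_def)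
  qed
  have all: "v \<in> S" if "v \<in> V" for v
    using connected_induct[OF x that x_S] S_step by blast
  have lev: "D x v + D y v = n" if "v \<in> V" for v
    using all[OF that] by (simp add: S_def)
  have step: "D x w = Suc (D x v) \<and> D y v = Suc (D y w) \<or> D x v = Suc (D x w) \<and> D y w = Suc (D y v)"
    if v: "v \<in> V" and w: "w \<in> nbrs v" for v w
  proof -
    have "w \<in> V" using w nbrs_V by blast
    then show ?thesis
      using closer[OF all[OF v] w] lev[OF v] lev[of w]
        dist_nbr_le[OF x w] dist_nbr_le[OF y w] by linarith
  qed
  have fibre_down: "(\<Sum>\<^sub>\<infinity>w\<in>{w \<in> V. D x w = j}. q v w) = toward x v"
    if v: "v \<in> V" and j: "D x v = Suc j" for v j
  proof (rule infsum_q_cong[OF v])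
    fix w assume "w \<in> nbrs v"
    then show "D x w = j \<longleftrightarrow> D x w < D x v"
      using step[OF v, of w] j by linarith
  qed
  have fibre_up: "(\<Sum>\<^sub>\<infinity>w\<in>{w \<in> V. D x w = j}. q v w) = toward y v"
    if v: "v \<in> V" and j: "j = Suc (D x v)" for v j
  proof (rule infsum_q_cong[OF v])
    fix w assume "w \<in> nbrs v"
    then show "D x w = j \<longleftrightarrow> D y w < D y v"
      using step[OF v, of w] j by linarith
  qed
  have fibre_zero: "(\<Sum>\<^sub>\<infinity>w\<in>{w \<in> V. D x w = j}. q v w) = 0"
    if "v \<in> V" "\<not> (j = Suc (D x v) \<or> D x v = Suc j)" for v j
  proof -
    have "nbrs v \<inter> {w \<in> V. D x w = j} = {}"
    proof (intro equals0I)
      fix w assume "w \<in> nbrs v \<inter> {w \<in> V. D x w = j}"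
      then show False
        using step[OF that(1), of w] that(2) by auto
    qed
    then show ?thesis
      using infsum_q[OF that(1), of "{w \<in> V. D x w = j}"] by auto
  qed
  have fibres: "(\<Sum>\<^sub>\<infinity>w\<in>{w \<in> V. D x w = j}. q v w) = simple_random_walk (line_edges n) (D x v) j"
    if v: "v \<in> V" and j: "j \<le> n" for v j
  proof -
    have ends: "D x v = 0 \<longleftrightarrow> v = x" "D x v = n \<longleftrightarrow> v = y"
      using dist_eq_0[OF x v] dist_eq_0[OF y v] lev[OF v] by auto
    have le: "D x v \<le> n"
      using lev[OF v] by simp
    consider "D x v = Suc j" | "j = Suc (D x v)" | "\<not> (j = Suc (D x v) \<or> D x v = Suc j)"
      by blast
    then show ?thesis
    proof cases
      case 1
      then have "v \<noteq> x" using ends by auto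
      then have "toward x v = (if v = y then 1 else 1 / 2)"
        using half[of v] assms(2) v by simp
      then show ?thesis
        unfolding fibre_down[OF v 1] simple_random_walk_line[OF n_pos le j] ends
        using \<open>v \<noteq> x\<close> 1 by simp
    next
      case 2
      then have "v \<noteq> y" using ends j by auto
      then have "toward y v = (if v = x then 1 else 1 / 2)"
        using half[of v] assms(1) v by simp
      then show ?thesis
        unfolding fibre_up[OF v 2] simple_random_walk_line[OF n_pos le j] ends
        using \<open>v \<noteq> y\<close> 2 by simp
    next
      case 3
      then show ?thesis
        using fibre_zero[OF v 3] by (simp add: simple_random_walk_line[OF n_pos le j])
    qed
  qed
  have "D x ` V = {0..n}"
  proof
    show "D x ` V \<subseteq> {0..n}"
    proof
      fix j assume "j \<in> D x ` V"
      then obtain v where "v \<in> V" "j = D x v" by blast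
      then show "j \<in> {0..n}"
        using lev[of v] by simp
    qed
    show "{0..n} \<subseteq> D x ` V"
    proof
      fix j assume "j \<in> {0..n}"
      \<comment> \<open>Layers are counted from \<open>y\<close>, whereas the projection counts from
        \<open>x\<close>.\<close>
      then obtain v where "v \<in> S" "D y v = n - j"
        using layer.layer_nonempty[of "n - j"] by auto
      then have "v \<in> V" "D x v = j"
        using \<open>j \<in> {0..n}\<close> by (auto simp: S_def)
      then show "j \<in> D x ` V" by blast
    qed
  qed
  moreover have "{v \<in> V. D x v = 0} = {x}"
    using dist_eq_0[OF x] x by auto
  moreover have "{v \<in> V. D x v = n} = {y}"
  proof (intro equalityI subsetI)
    fix v assume "v \<in> {v \<in> V. D x v = n}"
    then show "v \<in> {y}"
      using dist_eq_0[OF y, of v] lev[of v] by simp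
  qed (use y dist_xy in simp)
  ultimately show ?thesis
    unfolding projects_to_line_def chain_projection_def line_verts_def
    using fibres by (intro exI[of _ "D x"] conjI ballI) (simp_all only: atLeastAtMost_iff)
qed

end

theorem lemma10:
  fixes V :: "'a set" and E :: "'a set set" and q :: "'a \<Rightarrow> 'a \<Rightarrow> real"
    and x y :: 'a and n :: nat
  assumes "simple_graph V E"
    and "locally_finite_graph V E"
    and "connected_graph V E"
    and "markov_chain V q"
    and "nearest_neighbour V E q"
    and "reversible_chain V q"
    and "x \<in> V" and "y \<in> V" and "x \<noteq> y"
    and "n = graph_dist E x y"
  shows "nstep V q n x y * nstep V q n y x \<le> 4 powi (1 - int n) \<and>
    (nstep V q n x y * nstep V q n y x = 4 powi (1 - int n) \<longleftrightarrow>
       (\<Sum>\<^sub>\<infinity>w\<in>{w \<in> V. graph_dist E y w < graph_dist E y x}. q x w) = 1 \<and>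
       (\<Sum>\<^sub>\<infinity>w\<in>{w \<in> V. graph_dist E x w < graph_dist E x y}. q y w) = 1 \<and>
       (\<forall>v\<in>V - {x, y}.
          (\<Sum>\<^sub>\<infinity>w\<in>{w \<in> V. graph_dist E x w < graph_dist E x v}. q v w) = 1 / 2 \<and>
          (\<Sum>\<^sub>\<infinity>w\<in>{w \<in> V. graph_dist E y w < graph_dist E y v}. q v w) = 1 / 2)) \<and>
    (nstep V q n x y * nstep V q n y x = 4 powi (1 - int n) \<longleftrightarrow> projects_to_line V q x y n)"
    (is "?le \<and> (?eq \<longleftrightarrow> ?a \<and> ?b \<and> ?c) \<and> (?eq \<longleftrightarrow> ?proj)")
proof -
  obtain m where m: "\<forall>u\<in>V. m u > 0" "\<forall>u\<in>V. \<forall>v\<in>V. m u * q u v = m v * q v u"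
    using assms(6) unfolding reversible_chain_def by blast
  interpret reversible_walk_pair V E q m x y n
    by unfold_locales (use assms m in auto)
  show ?thesis
    using return_le equality_imp_toward toward_imp_projects
      projects_imp_equality[OF n_pos x y] by blast
qed

end
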